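(* There is an algorithm which, given an instance $F=(F_1(X^1),\dots,F_n)$ of hierarchical 3SAT specifying the 3CNF formula $f$, runs in time $\sum_{1\le i\le n}O(n_i+m_i)$ and constructs a hierarchical specification of size $\sum_{1\le i\le n}O(n_i)$ of a truth assignment to the variables of $f$ that satisfies at least half of the clauses of $f$ (clauses counted with multiplicity over all expansions).
   Context: An instance $F=(F_1(X^1),\dots,F_n(X^n))$ of hierarchical 3SAT has the form $F_i(X^i)=\big(\bigwedge_{j} F_{i_j}(X^i_j,Z^i_j)\big)\wedge f_i(X^i,Z^i)$ for $1\le i\le n$, where each $f_i$ is a 3CNF formula, $X^n=\emptyset$, $X^i,Z^i$ are vectors of Boolean variables, $X^i_j\subseteq X^i$, $Z^i_j\subseteq Z^i$, and each $i_j<i$ (so $F_1$ is just a 3CNF formula). $F$ specifies the 3CNF formula $f$ obtained by expanding the $F_j$ as macros, with the $Z$-variables introduced in different expansions considered distinct. $n_i=|X^i|+|Z^i|$ is the number of variables used in $F_i$ and $m_i$ is the number of clauses in $F_i$. *)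

theory Defs
  imports Complex_Main "HOL-Library.Landau_Symbols"
begin

section \<open>Hierarchical 3SAT\<close>

text \<open>
  \<open>Param k\<close> is the \<open>k\<close>-th entry of the parameter vector \<open>X\<^sup>i\<close> and \<open>Local k\<close> the \<open>k\<close>-th entry
  of \<open>Z\<^sup>i\<close>; all indices, including those of the macros themselves, start at 0.
\<close>

datatype var = Param nat | Local nat

datatype 'v literal = Pos 'v | Neg 'v

type_synonym 'v clause = "'v literal list"

text \<open>
  The argument vector of a call consists of entries of \<open>X\<^sup>i\<close> (they form \<open>X\<^sup>i\<^sub>j\<close>) and of entries
  of \<open>Z\<^sup>i\<close> (they form \<open>Z\<^sup>i\<^sub>j\<close>), in any order.
\<close>

datatype call = Call (callee: nat) (args: "var list")

datatype macro =
  Macro (nparams: nat) (nlocals: nat) (calls: "call list") (clauses: "var clause list")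

fun var_ok :: "macro \<Rightarrow> var \<Rightarrow> bool" where
  "var_ok M (Param k) \<longleftrightarrow> k < nparams M"
| "var_ok M (Local k) \<longleftrightarrow> k < nlocals M"

text \<open>
  A 3CNF clause has one, two or three literals, which may repeat; this includes the convention
  of exactly three literals.
\<close>

definition clause_ok :: "macro \<Rightarrow> var clause \<Rightarrow> bool" where
  "clause_ok M c \<longleftrightarrow> 1 \<le> length c \<and> length c \<le> 3 \<and> (\<forall>l \<in> set c. \<forall>v \<in> set_literal l. var_ok M v)"

definition hier_3sat :: "macro list \<Rightarrow> bool" where
  "hier_3sat F \<longleftrightarrow>
     F \<noteq> [] \<and> nparams (last F) = 0 \<and>
     (\<forall>i < length F.
        (\<forall>c \<in> set (clauses (F ! i)). clause_ok (F ! i) c) \<and>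
        (\<forall>c \<in> set (calls (F ! i)).
           callee c < i \<and>
           length (args c) = nparams (F ! callee c) \<and>
           (\<forall>v \<in> set (args c). var_ok (F ! i) v)))"

definition num_vars :: "macro \<Rightarrow> nat" where
  "num_vars M = nparams M + nlocals M"

text \<open>
  The clauses of a macro are all of its conjuncts, a macro call being one of them
  (whatever the length of its argument vector).
\<close>

definition num_clauses :: "macro \<Rightarrow> nat" where
  "num_clauses M = length (calls M) + length (clauses M)"

section \<open>The specified formula\<close>

text \<open>
  \<open>Inst p i k\<close> is the copy of the \<open>k\<close>-th entry of \<open>Z\<^sup>i\<close> that belongs to the expansion of macro \<open>i\<close>
  at path \<open>p\<close>. The path lists the positions of the nested calls that led to this expansion,
  innermost first, so different expansions have different paths.
\<close>

datatype xvar = Inst "nat list" nat nat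

fun bind :: "nat \<Rightarrow> nat list \<Rightarrow> xvar list \<Rightarrow> var \<Rightarrow> xvar" where
  "bind i p as (Param k) = as ! k"
| "bind i p as (Local k) = Inst p i k"

text \<open>
  The test \<open>callee c < i\<close> holds for every call of an instance; it only serves to make the
  recursion total.
\<close>

function expand :: "macro list \<Rightarrow> nat \<Rightarrow> nat list \<Rightarrow> xvar list \<Rightarrow> xvar clause list" where
  "expand F i p as =
     concat (map (\<lambda>(j, c).
         if callee c < i
         then expand F (callee c) (j # p) (map (bind i p as) (args c))
         else [])
       (enumerate 0 (calls (F ! i))))
     @ map (map (map_literal (bind i p as))) (clauses (F ! i))"
  by pat_completeness auto
termination
  by (relation "measure (\<lambda>(F, i, p, as). i)") auto

declare expand.simps [simp del]

definition specified_formula :: "macro list \<Rightarrow> xvar clause list" where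
  "specified_formula F = expand F (length F - 1) [] []"

fun sat_literal :: "('v \<Rightarrow> bool) \<Rightarrow> 'v literal \<Rightarrow> bool" where
  "sat_literal \<sigma> (Pos v) \<longleftrightarrow> \<sigma> v"
| "sat_literal \<sigma> (Neg v) \<longleftrightarrow> \<not> \<sigma> v"

definition num_satisfied :: "('v \<Rightarrow> bool) \<Rightarrow> 'v clause list \<Rightarrow> nat" where
  "num_satisfied \<sigma> f = length (filter (\<lambda>c. \<exists>l \<in> set c. sat_literal \<sigma> l) f)"

section \<open>Hierarchical specifications of truth assignments\<close>

text \<open>
  A hierarchical specification gives, for each macro \<open>i\<close>, one truth value to each entry of
  \<open>Z\<^sup>i\<close>; the assignment that it specifies gives this value to all copies of the entry.
\<close>

type_synonym hier_assignment = "bool list list"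

definition hier_assignment_for :: "macro list \<Rightarrow> hier_assignment \<Rightarrow> bool" where
  "hier_assignment_for F A \<longleftrightarrow>
     length A = length F \<and> (\<forall>i < length F. length (A ! i) = nlocals (F ! i))"

fun specified_assignment :: "hier_assignment \<Rightarrow> xvar \<Rightarrow> bool" where
  "specified_assignment A (Inst p i k) = A ! i ! k"

section \<open>Random access machines with uniform cost\<close>

text \<open>
  Programs run on a random access machine with registers, a memory and a write-only output
  tape, all of whose cells hold natural numbers. The only arithmetic operations are addition
  and truncated subtraction; both conditionals test a register for being nonzero. Every
  executed instruction and every test costs one time unit.
\<close>

type_synonym reg = nat

datatype com =
    Skip
  | Const reg nat
  | Add reg reg reg
  | Sub reg reg reg
  | Load reg reg
  | Store reg reg
  | Output reg
  | Seq com com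
  | Cond reg com com
  | While reg com

datatype state = State (regs: "reg \<Rightarrow> nat") (mem: "nat \<Rightarrow> nat") (out: "nat list")

inductive exec :: "com \<Rightarrow> state \<Rightarrow> nat \<Rightarrow> state \<Rightarrow> bool" where
  exec_Skip: "exec Skip s 1 s"
| exec_Const: "exec (Const x n) (State r m w) 1 (State (r(x := n)) m w)"
| exec_Add: "exec (Add x y z) (State r m w) 1 (State (r(x := r y + r z)) m w)"
| exec_Sub: "exec (Sub x y z) (State r m w) 1 (State (r(x := r y - r z)) m w)"
| exec_Load: "exec (Load x y) (State r m w) 1 (State (r(x := m (r y))) m w)"
| exec_Store: "exec (Store x y) (State r m w) 1 (State r (m(r x := r y)) w)"
| exec_Output: "exec (Output x) (State r m w) 1 (State r m (w @ [r x]))"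
| exec_Seq: "exec c s t s' \<Longrightarrow> exec d s' u s'' \<Longrightarrow> exec (Seq c d) s (t + u) s''"
| exec_Cond_True: "regs s x \<noteq> 0 \<Longrightarrow> exec c s t s' \<Longrightarrow> exec (Cond x c d) s (1 + t) s'"
| exec_Cond_False: "regs s x = 0 \<Longrightarrow> exec d s t s' \<Longrightarrow> exec (Cond x c d) s (1 + t) s'"
| exec_While_False: "regs s x = 0 \<Longrightarrow> exec (While x c) s 1 s"
| exec_While_True: "regs s x \<noteq> 0 \<Longrightarrow> exec c s t s' \<Longrightarrow> exec (While x c) s' u s'' \<Longrightarrow>
    exec (While x c) s (1 + t + u) s''"

inductive_cases exec_SkipE: "exec Skip s t s'"
  and exec_ConstE: "exec (Const x n) s t s'"
  and exec_AddE: "exec (Add x y z) s t s'"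
  and exec_SubE: "exec (Sub x y z) s t s'"
  and exec_LoadE: "exec (Load x y) s t s'"
  and exec_StoreE: "exec (Store x y) s t s'"
  and exec_OutputE: "exec (Output x) s t s'"
  and exec_SeqE: "exec (Seq c d) s t s'"
  and exec_CondE: "exec (Cond x c d) s t s'"
  and exec_WhileE: "exec (While x c) s t s'"

text \<open>
  Programs are deterministic, so a run that is claimed to exist is the only one.
\<close>

lemma exec_deterministic:
  assumes "exec c s t s'" and "exec c s u s''"
  shows "u = t \<and> s'' = s'"
  using assms
proof (induction arbitrary: u s'' rule: exec.induct)
  case (exec_Seq c s t s' d v s2)
  from exec_Seq.prems obtain t1 u1 s1
    where *: "u = t1 + u1" "exec c s t1 s1" "exec d s1 u1 s''"
    by (blast elim: exec_SeqE)
  from exec_Seq.IH(1)[OF *(2)] have "t1 = t" "s1 = s'" by blast+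
  with exec_Seq.IH(2) *(1,3) show ?case by blast
next
  case (exec_Cond_True s x c t s' d)
  from exec_Cond_True.prems exec_Cond_True.hyps(1) obtain t1
    where *: "u = Suc t1" "exec c s t1 s''"
    by (auto elim: exec_CondE)
  from exec_Cond_True.IH[OF *(2)] *(1) show ?case by simp
next
  case (exec_Cond_False s x d t s' c)
  from exec_Cond_False.prems exec_Cond_False.hyps(1) obtain t1
    where *: "u = Suc t1" "exec d s t1 s''"
    by (auto elim: exec_CondE)
  from exec_Cond_False.IH[OF *(2)] *(1) show ?case by simp
next
  case (exec_While_False s x c)
  then show ?case by (auto elim: exec_WhileE)
next
  case (exec_While_True s x c t s' v s2)
  from exec_While_True.prems exec_While_True.hyps(1) obtain t1 u1 s1
    where *: "u = 1 + t1 + u1" "exec c s t1 s1" "exec (While x c) s1 u1 s''"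
    by (auto elim: exec_WhileE)
  from exec_While_True.IH(1)[OF *(2)] have "t1 = t" "s1 = s'" by blast+
  with exec_While_True.IH(2) *(1,3) show ?case by blast
next
  case exec_Skip then show ?case by (rule exec_SkipE) simp
next
  case exec_Const then show ?case by (rule exec_ConstE) simp
next
  case exec_Add then show ?case by (rule exec_AddE) simp
next
  case exec_Sub then show ?case by (rule exec_SubE) simp
next
  case exec_Load then show ?case by (rule exec_LoadE) simp
next
  case exec_Store then show ?case by (rule exec_StoreE) simp
next
  case exec_Output then show ?case by (rule exec_OutputE) simp
qed

text \<open>
  The input is placed in the memory from address 0 on, and its length in register 0.
\<close>

definition initial_state :: "nat list \<Rightarrow> state" where
  "initial_state w =
     State (\<lambda>x. if x = 0 then length w else 0) (\<lambda>a. if a < length w then w ! a else 0) []"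

section \<open>Encodings as sequences of machine words\<close>

fun encode_var :: "var \<Rightarrow> nat list" where
  "encode_var (Param k) = [0, k]"
| "encode_var (Local k) = [1, k]"

fun encode_literal :: "var literal \<Rightarrow> nat list" where
  "encode_literal (Neg v) = 0 # encode_var v"
| "encode_literal (Pos v) = 1 # encode_var v"

definition encode_clause :: "var clause \<Rightarrow> nat list" where
  "encode_clause c = length c # concat (map encode_literal c)"

definition encode_call :: "call \<Rightarrow> nat list" where
  "encode_call c = [callee c, length (args c)] @ concat (map encode_var (args c))"

definition encode_macro :: "macro \<Rightarrow> nat list" where
  "encode_macro M =
     [nparams M, nlocals M, length (calls M), length (clauses M)]
     @ concat (map encode_call (calls M)) @ concat (map encode_clause (clauses M))"

definition encode_instance :: "macro list \<Rightarrow> nat list" where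
  "encode_instance F = length F # concat (map encode_macro F)"

definition encode_assignment :: "hier_assignment \<Rightarrow> nat list" where
  "encode_assignment A = concat (map (\<lambda>bs. length bs # map of_bool bs) A)"

end

theory Submission imports Defs begin

text \<open>
  The leading literal of a clause is satisfied by one of the two constant assignments, so one of
  them satisfies at least half of the clauses. The number of clauses of an expansion whose leading
  literal has a given sign is the sum of these numbers over the callees plus the number of such
  clauses in the macro itself; the machine computes it for all macros in order, with one addition
  per call, and skips the argument vectors without reading them.
\<close>

section \<open>Leading literals of the specified formula\<close>

text \<open>The recursion of \<open>expand\<close> with the formula forgotten: a callee contributes
  once per call, which yields multiplicities without expanding. The guard again only makes the
  recursion total.\<close>

function lead_count :: "bool \<Rightarrow> macro list \<Rightarrow> nat \<Rightarrow> nat" where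
  "lead_count b F i =
     (\<Sum>c\<leftarrow>calls (F ! i). if callee c < i then lead_count b F (callee c) else 0)
     + length (filter (\<lambda>c. sat_literal (\<lambda>_. b) (hd c)) (clauses (F ! i)))"
  by pat_completeness auto
termination
  by (relation "measure (\<lambda>(b, F, i). i)") auto

declare lead_count.simps [simp del]

lemma hier_3sat_clause:
  assumes "hier_3sat F" "i < length F" "c \<in> set (clauses (F ! i))"
  shows "clause_ok (F ! i) c" and "c \<noteq> []"
proof -
  show "clause_ok (F ! i) c" using assms by (auto simp: hier_3sat_def)
  then show "c \<noteq> []" by (auto simp: clause_ok_def)
qed

lemma hier_3sat_call:
  assumes "hier_3sat F" "i < length F" "c \<in> set (calls (F ! i))"
  shows "callee c < i" "length (args c) = nparams (F ! callee c)"
    "v \<in> set (args c) \<Longrightarrow> var_ok (F ! i) v"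
  using assms by (auto simp: hier_3sat_def)

lemma sat_literal_const_map [simp]:
  "sat_literal (\<lambda>_. b) (map_literal f l) = sat_literal (\<lambda>_. b) l"
  by (cases l) auto

lemma sat_literal_const_False [simp]:
  "sat_literal (\<lambda>_. False) l \<longleftrightarrow> \<not> sat_literal (\<lambda>_. True) l"
  by (cases l) auto

text \<open>The positions added by \<open>enumerate\<close> only name paths and do not affect
  counts.\<close>

lemma sum_list_enumerate:
  "(\<Sum>x\<leftarrow>enumerate n xs. f (snd x)) = (\<Sum>x\<leftarrow>xs. f x)"
  by (induction xs arbitrary: n) auto

text \<open>Renaming variables keeps the sign of every literal, so the count depends neither on the
  path \<open>p\<close> nor on the arguments \<open>as\<close>.\<close>

lemma lead_count_expand:
  assumes F: "hier_3sat F" and i: "i < length F"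
  shows "length (filter (\<lambda>c. sat_literal (\<lambda>_. b) (hd c)) (expand F i p as)) = lead_count b F i"
  using i
proof (induction i arbitrary: p as rule: less_induct)
  case (less i)
  let ?P = "\<lambda>c. sat_literal (\<lambda>_. b) (hd c)"
  let ?g = "\<lambda>(j, c). if callee c < i
      then expand F (callee c) (j # p) (map (bind i p as) (args c)) else []"
  have g: "length (filter ?P (?g x))
      = (if callee (snd x) < i then lead_count b F (callee (snd x)) else 0)" for x
    using less by (auto split: prod.splits)
  have "length (filter ?P (concat (map ?g (enumerate 0 (calls (F ! i))))))
      = (\<Sum>x\<leftarrow>enumerate 0 (calls (F ! i)). length (filter ?P (?g x)))"
    by (simp add: filter_concat length_concat comp_def)
  also have "\<dots> = (\<Sum>c\<leftarrow>calls (F ! i). if callee c < i then lead_count b F (callee c) else 0)"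
    unfolding g by (rule sum_list_enumerate)
  finally have 1: "length (filter ?P (concat (map ?g (enumerate 0 (calls (F ! i))))))
      = (\<Sum>c\<leftarrow>calls (F ! i). if callee c < i then lead_count b F (callee c) else 0)" .
  have 2: "length (filter ?P (map (map (map_literal (bind i p as))) (clauses (F ! i))))
      = length (filter ?P (clauses (F ! i)))"
  proof -
    \<comment> \<open>Nonemptiness of clauses enters here: \<open>hd\<close> commutes with
      \<open>map\<close> on nonempty lists.\<close>
    have "filter (?P \<circ> map (map_literal (bind i p as))) (clauses (F ! i))
        = filter ?P (clauses (F ! i))"
      using hier_3sat_clause(2)[OF F less.prems] by (intro filter_cong) (auto simp: hd_map)
    then show ?thesis by (simp add: filter_map)
  qed
  show ?case
    by (subst expand.simps, subst lead_count.simps) (simp only: filter_append length_append 1 2)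
qed

text \<open>Every variable of an expansion is an entry of \<open>as\<close> or an instance with
  indices in range, so a \<open>Q\<close> true of these is true throughout. The range matters
  because \<open>A ! i ! k\<close> is determined only inside it.\<close>

lemma expand_clauses:
  assumes F: "hier_3sat F" and i: "i < length F" and as: "length as = nparams (F ! i)"
    and Q: "\<And>p j k. j < length F \<Longrightarrow> k < nlocals (F ! j) \<Longrightarrow> Q (Inst p j k)"
    and Qas: "\<forall>x \<in> set as. Q x" and c: "c \<in> set (expand F i p as)"
  shows "c \<noteq> [] \<and> (\<forall>l \<in> set c. \<forall>x \<in> set_literal l. Q x)"
  using i as Qas c
proof (induction i arbitrary: p as rule: less_induct)
  case (less i)
  have bind: "Q (bind i p as v)" if "var_ok (F ! i) v" for v
    using that less.prems Q by (cases v) auto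
  from less.prems(4) consider
      (call) j d where "(j, d) \<in> set (enumerate 0 (calls (F ! i)))"
        "c \<in> set (expand F (callee d) (j # p) (map (bind i p as) (args d)))"
    | (clause) d where "d \<in> set (clauses (F ! i))" "c = map (map_literal (bind i p as)) d"
    by (subst (asm) expand.simps) (auto split: if_splits)
  then show ?case
  proof cases
    case call
    then have d: "d \<in> set (calls (F ! i))"
      unfolding enumerate_eq_zip by (metis set_zip_rightD)
    note d = hier_3sat_call[OF F less.prems(1) d]
    show ?thesis
      by (rule less.IH[OF d(1) _ _ _ call(2)]) (use d less.prems(1) bind in auto)
  next
    case clause
    with hier_3sat_clause[OF F less.prems(1), of d] bind show ?thesis
      by (auto simp: clause_ok_def literal.set_map)
  qed
qed

section \<open>Half of the clauses by a constant assignment\<close>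

text \<open>The two counts of the top macro cover all expansions, so comparing them suffices; a tie
  selects \<open>True\<close>.\<close>

lemma num_satisfied_constant:
  assumes F: "hier_3sat F"
    and b: "b \<longleftrightarrow> lead_count False F (length F - 1) \<le> lead_count True F (length F - 1)"
    and A: "A = map (\<lambda>M. replicate (nlocals M) b) F"
  shows "2 * num_satisfied (specified_assignment A) (specified_formula F)
    \<ge> length (specified_formula F)"
proof -
  let ?f = "specified_formula F" and ?n = "length F - 1"
  let ?P = "\<lambda>b c. sat_literal (\<lambda>_. b) (hd c)"
  have n: "?n < length F" and np: "nparams (F ! ?n) = 0"
    using F by (auto simp: hier_3sat_def last_conv_nth)
  have count: "length (filter (?P b') ?f) = lead_count b' F ?n" for b'
    unfolding specified_formula_def by (rule lead_count_expand[OF F n])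
  have "length ?f = lead_count True F ?n + lead_count False F ?n"
    using sum_length_filter_compl[of "?P True" ?f] count[of True] count[of False] by simp
  also have "\<dots> \<le> 2 * lead_count b F ?n"
    using b by (cases b) auto
  also have "lead_count b F ?n \<le> num_satisfied (specified_assignment A) ?f"
  proof -
    have sat: "\<exists>l \<in> set c. sat_literal (specified_assignment A) l" if "c \<in> set ?f" "?P b c" for c
    proof -
      have c: "c \<noteq> []" "\<forall>l \<in> set c. \<forall>x \<in> set_literal l. specified_assignment A x = b"
        using expand_clauses[OF F n, of "[]" "\<lambda>x. specified_assignment A x = b" c "[]"] that(1) np
        by (auto simp: specified_formula_def A)
      then have "\<forall>x \<in> set_literal (hd c). specified_assignment A x = b" by auto
      with that(2) have "sat_literal (specified_assignment A) (hd c)" by (cases "hd c") auto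
      with c(1) show ?thesis by auto
    qed
    \<comment> \<open>Filter lengths become cardinalities of sets of positions: inclusion then
      suffices, and repeated clauses stay separate.\<close>
    have "length (filter (?P b) ?f)
        \<le> length (filter (\<lambda>c. \<exists>l \<in> set c. sat_literal (specified_assignment A) l) ?f)"
      unfolding length_filter_conv_card
      by (rule card_mono) (use sat in auto)
    then show ?thesis by (simp add: count num_satisfied_def)
  qed
  finally show ?thesis by simp
qed

section \<open>Weakest preconditions with a clock\<close>

text \<open>\<open>t\<close> is the clock before the run; carrying it along lets a postcondition
  bound the total time. The existential over runs makes termination part of the claim.\<close>

definition wp :: "com \<Rightarrow> (nat \<Rightarrow> state \<Rightarrow> bool) \<Rightarrow> nat \<Rightarrow> state \<Rightarrow> bool" where
  "wp c Q t s \<longleftrightarrow> (\<exists>u s'. exec c s u s' \<and> Q (t + u) s')"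

lemma wp_mono: "wp c Q t s \<Longrightarrow> (\<And>t s. Q t s \<Longrightarrow> Q' t s) \<Longrightarrow> wp c Q' t s"
  by (auto simp: wp_def)

text \<open>Each instruction has exactly one run, so these are equations, and \<open>simp\<close>
  executes straight-line code symbolically.\<close>

lemma wp_simps [simp]:
  "wp (Const x n) Q t (State r m w) = Q (Suc t) (State (r(x := n)) m w)"
  "wp (Add x y z) Q t (State r m w) = Q (Suc t) (State (r(x := r y + r z)) m w)"
  "wp (Sub x y z) Q t (State r m w) = Q (Suc t) (State (r(x := r y - r z)) m w)"
  "wp (Load x y) Q t (State r m w) = Q (Suc t) (State (r(x := m (r y))) m w)"
  "wp (Store x y) Q t (State r m w) = Q (Suc t) (State r (m(r x := r y)) w)"
  "wp (Output x) Q t (State r m w) = Q (Suc t) (State r m (w @ [r x]))"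
  by (fastforce simp: wp_def intro: exec.intros
      elim: exec_ConstE exec_AddE exec_SubE exec_LoadE exec_StoreE exec_OutputE)+

lemma wp_Seq [simp]: "wp (Seq c d) Q = wp c (wp d Q)"
proof (intro ext iffI)
  fix t s
  assume "wp (Seq c d) Q t s"
  then obtain u s2 where "exec (Seq c d) s u s2" and Q: "Q (t + u) s2"
    by (auto simp: wp_def)
  then obtain u1 u2 s1 where "u = u1 + u2" "exec c s u1 s1" "exec d s1 u2 s2"
    by (blast elim: exec_SeqE)
  with Q show "wp c (wp d Q) t s"
    by (auto simp: wp_def add.assoc)
next
  fix t s
  assume "wp c (wp d Q) t s"
  then obtain u1 s1 u2 s2
    where "exec c s u1 s1" "exec d s1 u2 s2" and Q: "Q (t + (u1 + u2)) s2"
    by (auto simp: wp_def add.assoc)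
  then have "exec (Seq c d) s (u1 + u2) s2" by (intro exec_Seq)
  with Q show "wp (Seq c d) Q t s" unfolding wp_def by blast
qed

lemma wp_Cond [simp]:
  "wp (Cond x c d) Q t s = (if regs s x \<noteq> 0 then wp c Q (Suc t) s else wp d Q (Suc t) s)"
proof -
  let ?e = "if regs s x \<noteq> 0 then c else d"
  have iff: "exec (Cond x c d) s u s' \<longleftrightarrow> (\<exists>v. u = Suc v \<and> exec ?e s v s')" for u s'
    using exec_Cond_True[of s x c _ s' d] exec_Cond_False[of s x d _ s' c]
    by (auto elim: exec_CondE)
  have "wp (Cond x c d) Q t s \<longleftrightarrow> (\<exists>v s'. exec ?e s v s' \<and> Q (t + Suc v) s')"
    unfolding wp_def iff
    by (rule iffI; elim exE conjE; hypsubst?; intro exI conjI; (assumption | rule refl))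
  then show ?thesis by (simp add: wp_def)
qed

lemma wp_While_False: "regs s x = 0 \<Longrightarrow> Q (Suc t) s \<Longrightarrow> wp (While x c) Q t s"
  using exec_While_False[of s x c] by (force simp: wp_def)

lemma wp_While_True:
  assumes "regs s x \<noteq> 0" "wp c (wp (While x c) Q) (Suc t) s"
  shows "wp (While x c) Q t s"
proof -
  from assms(2) obtain u s1 v s2
    where "exec c s u s1" "exec (While x c) s1 v s2" and Q: "Q (t + (1 + u + v)) s2"
    by (auto simp: wp_def add.assoc)
  then have "exec (While x c) s (1 + u + v) s2" by (intro exec_While_True[OF assms(1)])
  with Q show ?thesis unfolding wp_def by blast
qed

text \<open>The loop register holds the length of the unprocessed part \<open>zs\<close>, so
  induction on \<open>zs\<close> gives termination as well. Each \<open>Suc t\<close> pays for a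
  test, including the one that leaves the loop.\<close>

lemma wp_While_list:
  assumes "J [] xs t s"
    and "\<And>ys zs t s. J ys zs t s \<Longrightarrow> regs s x = length zs"
    and "\<And>ys z zs t s. xs = ys @ z # zs \<Longrightarrow> J ys (z # zs) t s \<Longrightarrow> wp c (J (ys @ [z]) zs) (Suc t) s"
    and "\<And>t s. J xs [] t s \<Longrightarrow> Q (Suc t) s"
  shows "wp (While x c) Q t s"
proof -
  have "wp (While x c) Q t s" if "J ys zs t s" "xs = ys @ zs" for ys zs t s
    using that
  proof (induction zs arbitrary: ys t s)
    case Nil
    with assms(2,4) show ?case by (auto intro!: wp_While_False)
  next
    case (Cons z zs)
    from Cons.prems assms(2) have "regs s x \<noteq> 0" by auto
    moreover have "wp c (wp (While x c) Q) (Suc t) s"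
      using assms(3)[OF Cons.prems(2,1)] by (rule wp_mono) (use Cons in auto)
    ultimately show ?case by (rule wp_While_True)
  qed
  with assms(1) show ?thesis by auto
qed

section \<open>Words in the memory\<close>

definition stored :: "(nat \<Rightarrow> nat) \<Rightarrow> nat \<Rightarrow> nat list \<Rightarrow> bool" where
  "stored m p xs \<longleftrightarrow> (\<forall>i < length xs. m (p + i) = xs ! i)"

lemma stored_Nil [simp]: "stored m p []"
  by (simp add: stored_def)

lemma stored_Cons [simp]: "stored m p (x # xs) \<longleftrightarrow> m p = x \<and> stored m (Suc p) xs"
  by (auto simp: stored_def less_Suc_eq_0_disj)

lemma stored_append [simp]:
  "stored m p (xs @ ys) \<longleftrightarrow> stored m p xs \<and> stored m (p + length xs) ys"
  by (induction xs arbitrary: p) auto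

text \<open>For stores to the table, which lies behind the input.\<close>

lemma stored_upd: "p + length xs \<le> a \<Longrightarrow> stored (m(a := v)) p xs = stored m p xs"
  by (auto simp: stored_def)

lemma length_encode_vars [simp]: "length (concat (map encode_var vs)) = 2 * length vs"
proof -
  have "length (encode_var v) = 2" for v by (cases v) auto
  then show ?thesis by (induction vs) auto
qed

lemma length_encode_literals [simp]: "length (concat (map encode_literal ls)) = 3 * length ls"
proof -
  have "length (encode_literal l) = 3" for l
    using length_encode_vars[of "[v]" for v] by (cases l) auto
  then show ?thesis by (induction ls) auto
qed

lemma stored_encode_call:
  "stored m p (encode_call c) \<Longrightarrow> m p = callee c \<and> m (Suc p) = length (args c)"
  by (auto simp: encode_call_def)

text \<open>Written as a repeated sum, here and for clauses, to match the repeated additions that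
  advance the pointer.\<close>

lemma length_encode_call: "length (encode_call c) = Suc (Suc (length (args c) + length (args c)))"
  by (simp add: encode_call_def)

text \<open>An encoded literal starts with its sign, so the word after the clause length decides
  which counter to increase.\<close>

lemma stored_encode_clause:
  assumes "stored m p (encode_clause c)" "c \<noteq> []"
  shows "m p = length c" "m (Suc p) = of_bool (sat_literal (\<lambda>_. True) (hd c))"
proof -
  show "m p = length c" using assms by (simp add: encode_clause_def)
  obtain l c' where "c = l # c'" using assms(2) by (cases c) auto
  then show "m (Suc p) = of_bool (sat_literal (\<lambda>_. True) (hd c))"
    using assms by (cases l) (auto simp: encode_clause_def)
qed

lemma length_encode_clause: "length (encode_clause c) = Suc (length c + length c + length c)"
  by (simp add: encode_clause_def)

section \<open>The program\<close>

abbreviation (input) seq (infixr \<open>;;\<close> 60) where "c ;; d \<equiv> Seq c d"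

text \<open>Register 0 initially holds the input length, which is the first address behind the
  input; the table starts there.\<close>

abbreviation (input) "rbase \<equiv> 0 :: reg"
abbreviation (input) "rone \<equiv> 1 :: reg"
abbreviation (input) "rtodo \<equiv> 2 :: reg"
abbreviation (input) "rptr \<equiv> 3 :: reg"
abbreviation (input) "rtab \<equiv> 4 :: reg"
abbreviation (input) "rlocals \<equiv> 5 :: reg"
abbreviation (input) "rcalls \<equiv> 6 :: reg"
abbreviation (input) "rclauses \<equiv> 7 :: reg"
abbreviation (input) "rpos \<equiv> 8 :: reg"
abbreviation (input) "rneg \<equiv> 9 :: reg"
abbreviation (input) "rtmp \<equiv> 10 :: reg"
abbreviation (input) "raddr \<equiv> 11 :: reg"
abbreviation (input) "rlen \<equiv> 12 :: reg"

text \<open>A table entry has three words, so its address is \<open>rbase\<close> plus three times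
  the callee, formed by additions for want of multiplication.\<close>

definition call_loop :: com where
  "call_loop = While rcalls (
     Sub rcalls rcalls rone ;;
     Load rtmp rptr ;; Add rptr rptr rone ;;
     Add raddr rtmp rtmp ;; Add raddr raddr rtmp ;; Add raddr raddr rbase ;;
     Load rtmp raddr ;; Add rpos rpos rtmp ;;
     Add raddr raddr rone ;;
     Load rtmp raddr ;; Add rneg rneg rtmp ;;
     Load rtmp rptr ;; Add rptr rptr rone ;; Add rptr rptr rtmp ;; Add rptr rptr rtmp)"

text \<open>\<open>rptr\<close> stays on the leading sign while it is read; three words per literal
  then lead to the next clause.\<close>

definition clause_loop :: com where
  "clause_loop = While rclauses (
     Sub rclauses rclauses rone ;;
     Load rtmp rptr ;; Add rptr rptr rone ;; Load raddr rptr ;;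
     Cond raddr (Add rpos rpos rone) (Add rneg rneg rone) ;;
     Add rptr rptr rtmp ;; Add rptr rptr rtmp ;; Add rptr rptr rtmp)"

text \<open>The first increment steps over \<open>nparams\<close>. The number of locals is copied to
  the table so that the output pass need not parse the input again.\<close>

definition macro_body :: com where
  "macro_body =
     Add rptr rptr rone ;; Load rlocals rptr ;;
     Add rptr rptr rone ;; Load rcalls rptr ;;
     Add rptr rptr rone ;; Load rclauses rptr ;;
     Add rptr rptr rone ;;
     Const rpos 0 ;; Const rneg 0 ;;
     call_loop ;; clause_loop ;;
     Store rtab rpos ;; Add rtab rtab rone ;;
     Store rtab rneg ;; Add rtab rtab rone ;;
     Store rtab rlocals ;; Add rtab rtab rone"

definition count_loop :: com where
  "count_loop = While rtodo (Sub rtodo rtodo rone ;; macro_body)"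

definition bits_loop :: com where
  "bits_loop = While rlocals (Sub rlocals rlocals rone ;; Output rpos)"

text \<open>The first two increments of \<open>rtab\<close> pass over the two counts of a table
  entry; \<open>rpos\<close> by now holds the chosen truth value.\<close>

definition output_loop :: com where
  "output_loop = While rtodo (
     Sub rtodo rtodo rone ;;
     Add rtab rtab rone ;; Add rtab rtab rone ;; Load rlocals rtab ;; Add rtab rtab rone ;;
     Output rlocals ;; bits_loop)"

text \<open>
  With truncated subtraction, \<open>1 - (neg - pos)\<close> is the truth value of \<open>neg \<le> pos\<close>.
  Before the main loop \<open>rptr\<close> is 0 and after it \<open>rtodo\<close> is 0, so adding or subtracting them copies
  a register.
\<close>

definition program :: com where
  "program =
     Const rone 1 ;; Load rtodo rptr ;; Add rlen rtodo rptr ;; Add rtab rbase rptr ;;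
     Add rptr rptr rone ;;
     count_loop ;;
     Sub rneg rneg rpos ;; Sub rpos rone rneg ;;
     Sub rtab rbase rtodo ;; Add rtodo rlen rtodo ;;
     output_loop"

section \<open>Effect and running time of the counting loops\<close>

text \<open>\<open>f\<close> and \<open>g\<close> stand for the two tabulated counts of the callees.
  The last premise is a continuation, which also records the registers left unchanged. An iteration
  costs 15 instructions and a test.\<close>

lemma wp_call_loop:
  assumes "stored m (r rptr) (concat (map encode_call cs))"
    and "r rcalls = length cs" "r rone = 1"
    and "\<And>c. c \<in> set cs \<Longrightarrow> m (r rbase + 3 * callee c) = f (callee c)
      \<and> m (r rbase + 3 * callee c + 1) = g (callee c)"
    and "\<And>t' r'. t' \<le> t + 1 + 16 * length cs \<Longrightarrow>
      r' rptr = r rptr + length (concat (map encode_call cs)) \<Longrightarrow>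
      r' rpos = r rpos + (\<Sum>c\<leftarrow>cs. f (callee c)) \<Longrightarrow>
      r' rneg = r rneg + (\<Sum>c\<leftarrow>cs. g (callee c)) \<Longrightarrow>
      (\<And>x. x \<notin> {rptr, rcalls, rpos, rneg, rtmp, raddr} \<Longrightarrow> r' x = r x) \<Longrightarrow>
      Q t' (State r' m w)"
  shows "wp call_loop Q t (State r m w)"
  unfolding call_loop_def
proof (rule wp_While_list[where xs = cs and J = "\<lambda>ys zs t' s.
      t' \<le> t + 16 * length ys \<and> regs s rcalls = length zs \<and> mem s = m \<and> out s = w \<and>
      regs s rptr = r rptr + length (concat (map encode_call ys)) \<and>
      stored m (regs s rptr) (concat (map encode_call zs)) \<and>
      regs s rpos = r rpos + (\<Sum>c\<leftarrow>ys. f (callee c)) \<and>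
      regs s rneg = r rneg + (\<Sum>c\<leftarrow>ys. g (callee c)) \<and>
      (\<forall>x. x \<notin> {rptr, rcalls, rpos, rneg, rtmp, raddr} \<longrightarrow> regs s x = r x)"], goal_cases)
  case 1
  then show ?case using assms by simp
next
  case 2
  then show ?case by simp
next
  case (3 ys z zs t1 s)
  obtain r1 where s: "s = State r1 m w" using 3 by (cases s) auto
  have z: "m (r1 rptr) = callee z" "m (Suc (r1 rptr)) = length (args z)"
    using 3 stored_encode_call[of m "r1 rptr" z] by (auto simp: s)
  have next_call: "stored m (Suc (Suc (r1 rptr + length (args z) + length (args z))))
      (concat (map encode_call zs))"
    using 3 by (auto simp: s length_encode_call add.assoc)
  \<comment> \<open>The left-hand side is the address as the program's additions produce it.\<close>
  have a: "callee z + callee z + callee z + r rbase = r rbase + 3 * callee z" by simp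
  have fg: "m (r rbase + 3 * callee z) = f (callee z)"
    "m (Suc (r rbase + 3 * callee z)) = g (callee z)"
    using assms(4)[of z] 3 by auto
  show ?case using 3 z next_call fg assms(3) by (simp add: s a length_encode_call)
next
  case (4 t1 s)
  then show ?case using assms(5)[of "Suc t1" "regs s"] by (cases s) auto
qed

text \<open>Both branches of the \<open>Cond\<close> cost the same; an iteration takes eight
  instructions and two tests.\<close>

lemma wp_clause_loop:
  assumes "stored m (r rptr) (concat (map encode_clause cs))"
    and "r rclauses = length cs" "r rone = 1"
    and "[] \<notin> set cs"
    and "\<And>t' r'. t' \<le> t + 1 + 10 * length cs \<Longrightarrow>
      r' rptr = r rptr + length (concat (map encode_clause cs)) \<Longrightarrow>
      r' rpos = r rpos + length (filter (\<lambda>c. sat_literal (\<lambda>_. True) (hd c)) cs) \<Longrightarrow>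
      r' rneg = r rneg + length (filter (\<lambda>c. sat_literal (\<lambda>_. False) (hd c)) cs) \<Longrightarrow>
      (\<And>x. x \<notin> {rptr, rclauses, rpos, rneg, rtmp, raddr} \<Longrightarrow> r' x = r x) \<Longrightarrow>
      Q t' (State r' m w)"
  shows "wp clause_loop Q t (State r m w)"
  unfolding clause_loop_def
proof (rule wp_While_list[where xs = cs and J = "\<lambda>ys zs t' s.
      t' \<le> t + 10 * length ys \<and> regs s rclauses = length zs \<and> mem s = m \<and> out s = w \<and>
      regs s rptr = r rptr + length (concat (map encode_clause ys)) \<and>
      stored m (regs s rptr) (concat (map encode_clause zs)) \<and>
      regs s rpos = r rpos + length (filter (\<lambda>c. sat_literal (\<lambda>_. True) (hd c)) ys) \<and>
      regs s rneg = r rneg + length (filter (\<lambda>c. sat_literal (\<lambda>_. False) (hd c)) ys) \<and>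
      (\<forall>x. x \<notin> {rptr, rclauses, rpos, rneg, rtmp, raddr} \<longrightarrow> regs s x = r x)"], goal_cases)
  case 1
  then show ?case using assms by simp
next
  case 2
  then show ?case by simp
next
  case (3 ys z zs t1 s)
  obtain r1 where s: "s = State r1 m w" using 3 by (cases s) auto
  have z: "m (r1 rptr) = length z"
    "m (Suc (r1 rptr)) = of_bool (sat_literal (\<lambda>_. True) (hd z))"
    using 3 stored_encode_clause[of m "r1 rptr" z] assms(4) by (auto simp: s)
  have next_clause: "stored m (Suc (r1 rptr + length z + length z + length z))
      (concat (map encode_clause zs))"
    using 3 by (auto simp: s length_encode_clause add.assoc)
  show ?case using 3 z next_clause assms(3) by (simp add: s length_encode_clause)
next
  case (4 t1 s)
  then show ?case using assms(5)[of "Suc t1" "regs s"] by (cases s) auto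
qed

text \<open>17 is nine instructions before the loops, six after them, and two exit tests. A conjunct
  costs at most 16, the price of a call.\<close>

lemma wp_macro_body:
  assumes M: "stored m (r rptr) (encode_macro M)" and one: "r rone = 1"
    and calls: "\<And>c. c \<in> set (calls M) \<Longrightarrow> m (r rbase + 3 * callee c) = f (callee c)
      \<and> m (r rbase + 3 * callee c + 1) = g (callee c)"
    and clauses: "[] \<notin> set (clauses M)"
    and P: "P = (\<Sum>c\<leftarrow>calls M. f (callee c))
      + length (filter (\<lambda>c. sat_literal (\<lambda>_. True) (hd c)) (clauses M))"
    and N: "N = (\<Sum>c\<leftarrow>calls M. g (callee c))
      + length (filter (\<lambda>c. sat_literal (\<lambda>_. False) (hd c)) (clauses M))"
    and Q: "\<And>t' r'. t' \<le> t + 17 + 16 * num_clauses M \<Longrightarrow>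
      r' rptr = r rptr + length (encode_macro M) \<Longrightarrow> r' rtab = r rtab + 3 \<Longrightarrow>
      r' rpos = P \<Longrightarrow> r' rneg = N \<Longrightarrow>
      (\<And>x. x \<in> {rbase, rone, rtodo, rlen} \<Longrightarrow> r' x = r x) \<Longrightarrow>
      Q t' (State r' (m(r rtab := P, Suc (r rtab) := N, Suc (Suc (r rtab)) := nlocals M)) w)"
  shows "wp macro_body Q t (State r m w)"
proof -
  \<comment> \<open>The proof runs backwards: \<open>R\<close> is the precondition of the final
    stores, established by the clause loop, which in turn is the continuation of the call
    loop.\<close>
  define R where "R = wp (Store rtab rpos ;; Add rtab rtab rone ;;
     Store rtab rneg ;; Add rtab rtab rone ;;
     Store rtab rlocals ;; Add rtab rtab rone) Q"
  define p where "p = r rptr + 4"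
  define q where "q = p + length (concat (map encode_call (calls M)))"
  have m: "m (Suc (r rptr)) = nlocals M" "m (Suc (Suc (r rptr))) = length (calls M)"
    "m (Suc (Suc (Suc (r rptr)))) = length (clauses M)"
    and mc: "stored m p (concat (map encode_call (calls M)))"
    and md: "stored m q (concat (map encode_clause (clauses M)))"
    using M by (auto simp: encode_macro_def p_def q_def add.assoc numeral_eq_Suc)
  let ?keep = "\<lambda>r'. \<forall>x \<in> {rbase, rone, rtodo, rlen, rtab}. r' x = r x"
  have R: "R t' (State r' m w)"
    if "t' \<le> t + 11 + 16 * num_clauses M" "?keep r'" "r' rlocals = nlocals M"
      "r' rptr = r rptr + length (encode_macro M)" "r' rpos = P" "r' rneg = N" for t' r'
    using that one by (simp add: R_def) (rule Q, auto)
  have clause: "wp clause_loop R t' (State r' m w)"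
    if "t' \<le> t + 10 + 16 * length (calls M)" "?keep r'" "r' rlocals = nlocals M"
      "r' rptr = q" "r' rclauses = length (clauses M)"
      "r' rpos = (\<Sum>c\<leftarrow>calls M. f (callee c))" "r' rneg = (\<Sum>c\<leftarrow>calls M. g (callee c))" for t' r'
    by (rule wp_clause_loop[where cs = "clauses M"], goal_cases)
      (use that one clauses md in
        \<open>auto intro!: R simp: P N num_clauses_def encode_macro_def p_def q_def\<close>)
  have call: "wp call_loop (wp clause_loop R) t' (State r' m w)"
    if "t' = t + 9" "?keep r'" "r' rlocals = nlocals M"
      "r' rptr = p" "r' rcalls = length (calls M)" "r' rclauses = length (clauses M)"
      "r' rpos = 0" "r' rneg = 0" for t' r'
    by (rule wp_call_loop[where cs = "calls M" and f = f and g = g], goal_cases)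
      (use that one calls mc in \<open>auto intro!: clause simp: q_def\<close>)
  show ?thesis
    unfolding macro_body_def wp_Seq R_def[unfolded wp_Seq, symmetric]
    using m one by (auto intro!: call simp: p_def)
qed

section \<open>The table of counts and the pass over all macros\<close>

definition table :: "macro list \<Rightarrow> nat \<Rightarrow> nat \<Rightarrow> (nat \<Rightarrow> nat) \<Rightarrow> bool" where
  "table F n B m \<longleftrightarrow> (\<forall>i < n. m (B + 3 * i) = lead_count True F i \<and>
     m (B + 3 * i + 1) = lead_count False F i \<and> m (B + 3 * i + 2) = nlocals (F ! i))"

text \<open>The new entry lies beyond the first \<open>n\<close>; the updates have the shape that
  \<open>wp_macro_body\<close> produces.\<close>

lemma table_Suc:
  assumes "table F n B m" and "a = B + 3 * n"
  shows "table F (Suc n) B (m(a := lead_count True F n, Suc a := lead_count False F n,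
    Suc (Suc a) := nlocals (F ! n)))"
  using assms by (auto simp: table_def less_Suc_eq)

text \<open>Callees have smaller indices, so their entries are already in the table. 19 is the 17 of
  \<open>wp_macro_body\<close> plus a test and a decrement.\<close>

lemma wp_count_loop:
  assumes F: "hier_3sat F"
    and input: "stored m (r rptr) (concat (map encode_macro F))"
      "r rptr + length (concat (map encode_macro F)) = B"
    and r: "r rtodo = length F" "r rone = 1" "r rbase = B" "r rtab = B"
    and Q: "\<And>t' r' m'. t' \<le> t + 1 + (\<Sum>M\<leftarrow>F. 19 + 16 * num_clauses M) \<Longrightarrow>
      table F (length F) B m' \<Longrightarrow>
      r' rpos = lead_count True F (length F - 1) \<Longrightarrow>
      r' rneg = lead_count False F (length F - 1) \<Longrightarrow>
      r' rtodo = 0 \<Longrightarrow> r' rone = 1 \<Longrightarrow> r' rbase = B \<Longrightarrow> r' rlen = r rlen \<Longrightarrow>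
      Q t' (State r' m' w)"
  shows "wp count_loop Q t (State r m w)"
  unfolding count_loop_def
\<comment> \<open>The unread input ends at \<open>B\<close>, so stores from \<open>B\<close> on
  never touch it. \<open>rpos\<close> and \<open>rneg\<close> keep the counts of the last processed
  macro; at the start there is none, hence the condition on \<open>ys\<close>.\<close>
proof (rule wp_While_list[where xs = F and J = "\<lambda>ys zs t' s.
      t' \<le> t + (\<Sum>M\<leftarrow>ys. 19 + 16 * num_clauses M) \<and> regs s rtodo = length zs \<and> out s = w \<and>
      stored (mem s) (regs s rptr) (concat (map encode_macro zs)) \<and>
      regs s rptr + length (concat (map encode_macro zs)) = B \<and>
      regs s rone = 1 \<and> regs s rbase = B \<and> regs s rlen = r rlen \<and>
      regs s rtab = B + 3 * length ys \<and> table F (length ys) B (mem s) \<and>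
      (ys \<noteq> [] \<longrightarrow> regs s rpos = lead_count True F (length ys - 1) \<and>
        regs s rneg = lead_count False F (length ys - 1))"], goal_cases)
  case 1
  then show ?case using input r by (simp add: table_def)
next
  case 2
  then show ?case by simp
next
  case (3 ys M zs t1 s)
  obtain r1 m1 where s: "s = State r1 m1 w" using 3 by (cases s) auto
  have i: "length ys < length F" "F ! length ys = M" using 3(1) by auto
  have calls: "callee c < length ys" if "c \<in> set (calls M)" for c
    using hier_3sat_call(1)[OF F i(1)] i that by auto
  have tab: "m1 (B + 3 * j) = lead_count True F j"
    "m1 (Suc (B + 3 * j)) = lead_count False F j" if "j < length ys" for j
    using 3(2) that by (auto simp: s table_def)
  have clauses: "[] \<notin> set (clauses M)"
    using hier_3sat_clause(2)[OF F i(1)] i by auto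
  have count: "lead_count b F (length ys) = (\<Sum>c\<leftarrow>calls M. lead_count b F (callee c))
      + length (filter (\<lambda>c. sat_literal (\<lambda>_. b) (hd c)) (clauses M))" for b
    by (subst lead_count.simps) (simp add: i calls cong: map_cong)
  have rest: "stored (m1(a := x, Suc a := y, Suc (Suc a) := z))
      (r1 rptr + length (encode_macro M)) (concat (map encode_macro zs))"
    if "a = B + 3 * length ys" for a x y z
    using 3(2) that by (simp add: s stored_upd)
  have tab': "table F (Suc (length ys)) B (m1(a := lead_count True F (length ys),
      Suc a := lead_count False F (length ys), Suc (Suc a) := nlocals M))"
    if "a = B + 3 * length ys" for a
    using table_Suc[of F "length ys" B m1 a] 3(2) that i by (simp add: s)
  show ?case
    unfolding wp_Seq s wp_simps
    by (rule wp_macro_body[where M = M, OF _ _ _ clauses count count], goal_cases)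
      (use 3 calls tab rest tab' in \<open>auto simp: s\<close>)
next
  case (4 t1 s)
  \<comment> \<open>This turns the conditional part of the invariant into the counts of the top
    macro.\<close>
  moreover have "F \<noteq> []" using F by (simp add: hier_3sat_def)
  ultimately show ?case using Q[of "Suc t1" "mem s" "regs s"] by (cases s) auto
qed

section \<open>Writing the assignment\<close>

lemma wp_bits_loop:
  assumes "r rone = 1"
    and "\<And>t' r'. t' \<le> t + 1 + 3 * r rlocals \<Longrightarrow> (\<And>x. x \<noteq> rlocals \<Longrightarrow> r' x = r x) \<Longrightarrow>
      Q t' (State r' m (w @ replicate (r rlocals) (r rpos)))"
  shows "wp bits_loop Q t (State r m w)"
  unfolding bits_loop_def
\<comment> \<open>The list driving the loop is the word to be written, so \<open>ys\<close> is also
  the output of the loop so far.\<close>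
proof (rule wp_While_list[where xs = "replicate (r rlocals) (r rpos)" and J = "\<lambda>ys zs t' s.
      t' \<le> t + 3 * length ys \<and> regs s rlocals = length zs \<and> mem s = m \<and>
      out s = w @ ys \<and> (\<forall>x. x \<noteq> rlocals \<longrightarrow> regs s x = r x)"], goal_cases)
  case 1
  then show ?case by simp
next
  case 2
  then show ?case by simp
next
  case (3 ys z zs t1 s)
  then have "z \<in> set (replicate (r rlocals) (r rpos))" by (metis in_set_conv_decomp)
  then have "z = r rpos" by simp
  with 3(2) assms(1) show ?case by (cases s) simp
next
  case (4 t1 s)
  then show ?case using assms(2)[of "Suc t1" "regs s"] by (cases s) simp
qed

lemma wp_output_loop:
  assumes tab: "table F (length F) B m"
    and r: "r rtodo = length F" "r rone = 1" "r rtab = B"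
    and Q: "\<And>t' r'. t' \<le> t + 1 + (\<Sum>M\<leftarrow>F. 8 + 3 * nlocals M) \<Longrightarrow>
      Q t' (State r' m (w @ concat (map (\<lambda>M. nlocals M # replicate (nlocals M) (r rpos)) F)))"
  shows "wp output_loop Q t (State r m w)"
  unfolding output_loop_def
proof (rule wp_While_list[where xs = F and J = "\<lambda>ys zs t' s.
      t' \<le> t + (\<Sum>M\<leftarrow>ys. 8 + 3 * nlocals M) \<and> regs s rtodo = length zs \<and> mem s = m \<and>
      out s = w @ concat (map (\<lambda>M. nlocals M # replicate (nlocals M) (r rpos)) ys) \<and>
      regs s rone = 1 \<and> regs s rpos = r rpos \<and> regs s rtab = B + 3 * length ys"], goal_cases)
  case 1
  then show ?case using r by simp
next
  case 2
  then show ?case by simp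
next
  case (3 ys M zs t1 s)
  obtain r1 w1 where s: "s = State r1 m w1" using 3 by (cases s) auto
  have "m (B + 3 * length ys + 2) = nlocals M"
    using tab 3(1) by (auto simp: table_def)
  then show ?case
    unfolding wp_Seq s wp_simps
    by (intro wp_bits_loop) (use 3 in \<open>auto simp: s\<close>)
next
  case (4 t1 s)
  then show ?case using Q[of "Suc t1" "regs s"] by (cases s) simp
qed

text \<open>27 adds the per-macro costs 19 and 8 of the two passes; 12 covers the nine instructions
  outside the loops and two exit tests.\<close>

lemma wp_program:
  assumes F: "hier_3sat F"
    and b: "b \<longleftrightarrow> lead_count False F (length F - 1) \<le> lead_count True F (length F - 1)"
  shows "wp program (\<lambda>t s. t \<le> 12 + (\<Sum>M\<leftarrow>F. 27 + 16 * num_clauses M + 3 * nlocals M) \<and>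
      out s = concat (map (\<lambda>M. nlocals M # replicate (nlocals M) (of_bool b)) F))
    0 (initial_state (encode_instance F))"
proof -
  define B where "B = length (encode_instance F)"
  define m where "m = (\<lambda>a. if a < B then encode_instance F ! a else 0)"
  have m: "stored m 0 (encode_instance F)" by (simp add: stored_def m_def B_def)
  then have m0: "m 0 = length F" and m1: "stored m 1 (concat (map encode_macro F))"
    by (auto simp: encode_instance_def)
  have B: "1 + length (concat (map encode_macro F)) = B"
    by (simp add: B_def encode_instance_def)
  have init: "initial_state (encode_instance F) = State (\<lambda>x. if x = 0 then B else 0) m []"
    unfolding initial_state_def B_def m_def ..
  have bit: "1 - (lead_count False F (length F - 1) - lead_count True F (length F - 1)) = of_bool b"
    using b by auto
  let ?Q = "\<lambda>t s. t \<le> 12 + (\<Sum>M\<leftarrow>F. 27 + 16 * num_clauses M + 3 * nlocals M) \<and>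
      out s = concat (map (\<lambda>M. nlocals M # replicate (nlocals M) (of_bool b)) F)"
  have output_loop: "wp output_loop ?Q t (State r m' [])"
    if "t \<le> 10 + (\<Sum>M\<leftarrow>F. 19 + 16 * num_clauses M)" "table F (length F) B m'"
      "r rtodo = length F" "r rone = 1" "r rtab = B" "r rpos = of_bool b" for t r m'
  proof (rule wp_output_loop[OF that(2-5)])
    fix t' r'
    assume "t' \<le> t + 1 + (\<Sum>M\<leftarrow>F. 8 + 3 * nlocals M)"
    moreover have "(\<Sum>M\<leftarrow>F. 27 + 16 * num_clauses M + 3 * nlocals M)
        = (\<Sum>M\<leftarrow>F. 19 + 16 * num_clauses M) + (\<Sum>M\<leftarrow>F. 8 + 3 * nlocals M)"
      by (subst sum_list_addf[symmetric]) (simp add: algebra_simps)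
    ultimately show "?Q t' (State r' m'
        ([] @ concat (map (\<lambda>M. nlocals M # replicate (nlocals M) (r rpos)) F)))"
      using that(1,6) by simp
  qed
  show ?thesis
    unfolding program_def wp_Seq init wp_simps
  proof (rule wp_count_loop[OF F, where B = B], goal_cases)
    case (7 t' r' m')
    show ?case
      unfolding wp_simps
      by (rule output_loop) (use 7 m0 bit in simp_all)
  qed (use m0 m1 B in auto)
qed

section \<open>Asymptotic bounds\<close>

text \<open>From \<open>k = 1\<close> on, \<open>k\<close> absorbs the constant. The bound is
  asymptotic, so the value at 0 may be positive, as suits a macro without variables and conjuncts,
  which still takes time.\<close>

lemma bigo_affine: "(\<lambda>k. a + b * real k) \<in> O(\<lambda>k. real k)"
proof (rule bigoI[where c = "\<bar>a\<bar> + \<bar>b\<bar>"])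
  show "\<forall>\<^sub>F k in sequentially. norm (a + b * real k) \<le> (\<bar>a\<bar> + \<bar>b\<bar>) * norm (real k)"
    using eventually_ge_at_top[of 1]
  proof eventually_elim
    case (elim k)
    then have "\<bar>a\<bar> * 1 \<le> \<bar>a\<bar> * real k" by (intro mult_left_mono) auto
    then show ?case
      using abs_triangle_ineq[of a "b * real k"] by (simp add: abs_mult algebra_simps)
  qed
qed

theorem theorem6p7:
  "\<exists>(P :: com) (T :: nat \<Rightarrow> real) (S :: nat \<Rightarrow> real).
     T \<in> O(\<lambda>k. real k) \<and> S \<in> O(\<lambda>k. real k) \<and>
     (\<forall>F. hier_3sat F \<longrightarrow>
        (\<exists>t s A.
           exec P (initial_state (encode_instance F)) t s \<and>
           real t \<le> (\<Sum>i<length F. T (num_vars (F ! i) + num_clauses (F ! i))) \<and>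
           out s = encode_assignment A \<and>
           hier_assignment_for F A \<and>
           real (length (out s)) \<le> (\<Sum>i<length F. S (num_vars (F ! i))) \<and>
           2 * num_satisfied (specified_assignment A) (specified_formula F)
             \<ge> length (specified_formula F)))"
proof (rule exI[of _ program], rule exI[of _ "\<lambda>k. 39 + 16 * real k"],
    rule exI[of _ "\<lambda>k. 1 + 1 * real k"], intro conjI allI impI, goal_cases)
  case 1
  show ?case by (rule bigo_affine)
next
  case 2
  show ?case by (rule bigo_affine)
next
  \<comment> \<open>In \<open>?T\<close>, 39 is 27 per macro plus 12 for the whole run, and 16 also
    dominates the factor 3 of the locals. In \<open>?S\<close>, 1 is the length word.\<close>
  let ?T = "\<lambda>k. 39 + 16 * real k" and ?S = "\<lambda>k. 1 + 1 * real k"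
  case F: (3 F)
  define b where "b \<longleftrightarrow> lead_count False F (length F - 1) \<le> lead_count True F (length F - 1)"
  define A where "A = map (\<lambda>M. replicate (nlocals M) b) F"
  from wp_program[OF F b_def] obtain t s
    where ex: "exec program (initial_state (encode_instance F)) t s"
      and t: "t \<le> 12 + (\<Sum>M\<leftarrow>F. 27 + 16 * num_clauses M + 3 * nlocals M)"
      and out: "out s = concat (map (\<lambda>M. nlocals M # replicate (nlocals M) (of_bool b)) F)"
    by (auto simp: wp_def)
  have sum: "(\<Sum>M\<leftarrow>F. h M) = (\<Sum>i<length F. h (F ! i))" for h :: "macro \<Rightarrow> nat"
    by (simp add: sum_list_sum_nth atLeast0LessThan)
  \<comment> \<open>There is at least one macro, so the additive 12 can be charged to every
    macro.\<close>
  have "12 \<le> (\<Sum>i<length F. 12 :: nat)"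
    using F by (cases F) (auto simp: hier_3sat_def)
  then have "t \<le> (\<Sum>i<length F. 39 + 16 * num_clauses (F ! i) + 3 * nlocals (F ! i))"
    using t unfolding sum by (simp add: sum.distrib)
  also have "\<dots> \<le> (\<Sum>i<length F. 39 + 16 * (num_vars (F ! i) + num_clauses (F ! i)))"
    by (rule sum_mono) (simp add: num_vars_def)
  finally have "real t \<le> real (\<Sum>i<length F. 39 + 16 * (num_vars (F ! i) + num_clauses (F ! i)))"
    by (rule of_nat_mono)
  then have time: "real t \<le> (\<Sum>i<length F. ?T (num_vars (F ! i) + num_clauses (F ! i)))"
    by simp
  have "length (out s) = (\<Sum>i<length F. 1 + nlocals (F ! i))"
    by (simp add: out length_concat comp_def sum)
  also have "\<dots> \<le> (\<Sum>i<length F. 1 + num_vars (F ! i))"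
    by (rule sum_mono) (simp add: num_vars_def)
  finally have "real (length (out s)) \<le> real (\<Sum>i<length F. 1 + num_vars (F ! i))"
    by (rule of_nat_mono)
  then have size: "real (length (out s)) \<le> (\<Sum>i<length F. ?S (num_vars (F ! i)))"
    by simp
  have spec: "out s = encode_assignment A" "hier_assignment_for F A"
    by (simp_all add: out A_def encode_assignment_def hier_assignment_for_def comp_def)
  show ?case
    by (intro exI[of _ t] exI[of _ s] exI[of _ A] conjI)
      (fact ex time spec size num_satisfied_constant[OF F b_def A_def])+
qed

end
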